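(* Let $n\ge 2$ and let $\mathrm L$ be the tabular logic $\models_{(\mathbf A,\mathsf t)}$ of type $\tau$, where $\mathbf A$ is a $\tau$-algebra with $|A|=n$ and $\mathsf t\in A$, with $A$ identified with $\{\mathsf e_1,\dots,\mathsf e_n\}$ so that $\mathsf t=\mathsf e_n$. With the translation $\phi\mapsto\phi^*$ described in the context, $n\mathrm{CL}$ is a conservative expansion of $\mathrm L$: for every set $\Gamma\cup\{\phi\}$ of $\tau$-formulas, $\Gamma\models_{(\mathbf A,\mathsf t)}\phi$ if and only if $\Gamma^*\models_{(\mathbf n,\mathsf e_n)}\phi^*$.
   Context: $\nu_n$ is the type with one $(n+1)$-ary symbol $q$ and constants $\mathsf e_1,\dots,\mathsf e_n$. The algebra $\mathbf n$ has universe $\{\mathsf e_1,\dots,\mathsf e_n\}$, constants interpreted as themselves and $q^{\mathbf n}(\mathsf e_j,x_1,\dots,x_n)=x_j$. For a type $\sigma$, $\sigma$-formulas are $\sigma$-terms over a fixed countable set of variables. For an algebra $\mathbf B$ of type $\sigma$ and $d\in B$, $\Gamma\models_{(\mathbf B,d)}\phi$ means: for every homomorphism $h$ from the $\sigma$-formula algebra to $\mathbf B$, if $h(\psi)=d$ for all $\psi\in\Gamma$ then $h(\phi)=d$; such a consequence relation with $\mathbf B$ finite is a tabular logic. $n\mathrm{CL}$ is $\models_{(\mathbf n,\mathsf e_n)}$. Translation: for each $k$-ary operation symbol $f$ of $\tau$ (regarding $f^{\mathbf A}$ as a function $\{\mathsf e_1,\dots,\mathsf e_n\}^k\to\{\mathsf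 e_1,\dots,\mathsf e_n\}$), fix a head normal form $f^\circ(x_1,\dots,x_k)$ of type $\nu_n$ whose term function on $\mathbf n$ equals $f^{\mathbf A}$ (head normal forms are generated by $t,t_i::=\mathsf e_i\mid x\mid q(x,t_1,\dots,t_n)$, $x$ a variable; such $f^\circ$ always exists). Then $x^*=x$ for variables and $f(\phi_1,\dots,\phi_k)^*=f^\circ(\phi_1^*/x_1,\dots,\phi_k^*/x_k)$; $\Gamma^*=\{\psi^*:\psi\in\Gamma\}$. *)

theory Defs
  imports "HOL-Library.FuncSet"
begin

record 'f signature =
  ops :: "'f set"
  arity :: "'f \<Rightarrow> nat"

record ('f, 'a) algebra =
  carrier :: "'a set"
  interp :: "'f \<Rightarrow> 'a list \<Rightarrow> 'a"

definition algebra_of_type :: "'f signature \<Rightarrow> ('f, 'a) algebra \<Rightarrow> bool" where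
  "algebra_of_type \<sigma> B \<longleftrightarrow>
     carrier B \<noteq> {} \<and>
     (\<forall>f\<in>ops \<sigma>. \<forall>as\<in>lists (carrier B). length as = arity \<sigma> f \<longrightarrow> interp B f as \<in> carrier B)"

definition homomorphism ::
    "'f signature \<Rightarrow> ('f, 'a) algebra \<Rightarrow> ('f, 'b) algebra \<Rightarrow> ('a \<Rightarrow> 'b) \<Rightarrow> bool" where
  "homomorphism \<sigma> B C h \<longleftrightarrow>
     h \<in> carrier B \<rightarrow> carrier C \<and>
     (\<forall>f\<in>ops \<sigma>. \<forall>as\<in>lists (carrier B). length as = arity \<sigma> f \<longrightarrow>
        h (interp B f as) = interp C f (map h as))"

datatype 'f trm = Var nat | App 'f "'f trm list"

inductive_set formulas :: "'f signature \<Rightarrow> 'f trm set" for \<sigma> where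
  Var: "Var x \<in> formulas \<sigma>"
| App: "f \<in> ops \<sigma> \<Longrightarrow> length ts = arity \<sigma> f \<Longrightarrow> \<forall>t\<in>set ts. t \<in> formulas \<sigma>
    \<Longrightarrow> App f ts \<in> formulas \<sigma>"

definition formula_algebra :: "'f signature \<Rightarrow> ('f, 'f trm) algebra" where
  "formula_algebra \<sigma> = \<lparr>carrier = formulas \<sigma>, interp = App\<rparr>"

primrec vars :: "'f trm \<Rightarrow> nat set" where
  "vars (Var x) = {x}"
| "vars (App f ts) = \<Union> (set (map vars ts))"

primrec eval :: "('f, 'a) algebra \<Rightarrow> (nat \<Rightarrow> 'a) \<Rightarrow> 'f trm \<Rightarrow> 'a" where
  "eval B v (Var x) = v x"
| "eval B v (App f ts) = interp B f (map (eval B v) ts)"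

primrec subst :: "(nat \<Rightarrow> 'f trm) \<Rightarrow> 'f trm \<Rightarrow> 'f trm" where
  "subst s (Var x) = s x"
| "subst s (App f ts) = App f (map (subst s) ts)"

text \<open>The formal variables \<open>x\<^sub>1, \<dots>, x\<^sub>k\<close> of a \<open>k\<close>-ary term are
  \<open>Var 0, \<dots>, Var (k - 1)\<close>; list positions are likewise counted from 0.\<close>

definition term_function :: "('f, 'a) algebra \<Rightarrow> 'f trm \<Rightarrow> 'a list \<Rightarrow> 'a" where
  "term_function B t as = eval B (\<lambda>i. as ! i) t"

definition consequence ::
    "'f signature \<Rightarrow> ('f, 'a) algebra \<Rightarrow> 'a \<Rightarrow> 'f trm set \<Rightarrow> 'f trm \<Rightarrow> bool" where
  "consequence \<sigma> B d \<Gamma> \<phi> \<longleftrightarrow>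
     (\<forall>h. homomorphism \<sigma> (formula_algebra \<sigma>) B h \<longrightarrow> (\<forall>\<psi>\<in>\<Gamma>. h \<psi> = d) \<longrightarrow> h \<phi> = d)"

datatype nu_sym = Q | E nat

definition nu :: "nat \<Rightarrow> nu_sym signature" where
  "nu n = \<lparr>ops = insert Q (E ` {1..n}), arity = (\<lambda>f. case f of Q \<Rightarrow> n + 1 | E i \<Rightarrow> 0)\<rparr>"

fun n_interp :: "nu_sym \<Rightarrow> nu_sym list \<Rightarrow> nu_sym" where
  "n_interp (E i) _ = E i"
| "n_interp Q (E j # xs) = xs ! (j - 1)"
| "n_interp Q _ = undefined"

text \<open>The elements of the algebra \<open>\<^bold>n\<close> are the constant symbols themselves.\<close>

definition n_algebra :: "nat \<Rightarrow> (nu_sym, nu_sym) algebra" where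
  "n_algebra n = \<lparr>carrier = E ` {1..n}, interp = n_interp\<rparr>"

definition nCL :: "nat \<Rightarrow> nu_sym trm set \<Rightarrow> nu_sym trm \<Rightarrow> bool" where
  "nCL n = consequence (nu n) (n_algebra n) (E n)"

inductive head_normal_form :: "nat \<Rightarrow> nu_sym trm \<Rightarrow> bool" for n where
  const: "i \<in> {1..n} \<Longrightarrow> head_normal_form n (App (E i) [])"
| var: "head_normal_form n (Var x)"
| q: "length ts = n \<Longrightarrow> \<forall>t\<in>set ts. head_normal_form n t
    \<Longrightarrow> head_normal_form n (App Q (Var x # ts))"

text \<open>\<open>\<iota>\<close> is the identification of the universe of \<open>A\<close> with
  \<open>{E 1, \<dots>, E n}\<close>, and \<open>c f\<close> is the chosen head normal form for the
  operation symbol \<open>f\<close>.\<close>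

definition hnf_choice ::
    "nat \<Rightarrow> 'f signature \<Rightarrow> ('f, 'a) algebra \<Rightarrow> ('a \<Rightarrow> nu_sym) \<Rightarrow> ('f \<Rightarrow> nu_sym trm) \<Rightarrow> bool" where
  "hnf_choice n \<tau> A \<iota> c \<longleftrightarrow>
     (\<forall>f\<in>ops \<tau>.
        head_normal_form n (c f) \<and>
        vars (c f) \<subseteq> {..<arity \<tau> f} \<and>
        (\<forall>as\<in>lists (carrier A). length as = arity \<tau> f \<longrightarrow>
           term_function (n_algebra n) (c f) (map \<iota> as) = \<iota> (interp A f as)))"

primrec translate :: "('f \<Rightarrow> nu_sym trm) \<Rightarrow> 'f trm \<Rightarrow> nu_sym trm" where
  "translate c (Var x) = Var x"
| "translate c (App f ts) = subst (\<lambda>i. map (translate c) ts ! i) (c f)"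

lemma algebra_of_type_n_algebra:
  assumes "n \<ge> 1"
  shows "algebra_of_type (nu n) (n_algebra n)"
  unfolding algebra_of_type_def
proof (intro conjI ballI impI)
  show "carrier (n_algebra n) \<noteq> {}" using assms by (auto simp: n_algebra_def)
next
  fix f as
  assume f: "f \<in> ops (nu n)" and as: "as \<in> lists (carrier (n_algebra n))" "length as = arity (nu n) f"
  show "interp (n_algebra n) f as \<in> carrier (n_algebra n)"
  proof (cases f)
    case Q
    then obtain j xs where "as = E j # xs" "j \<in> {1..n}" "length xs = n" "\<forall>x\<in>set xs. x \<in> E ` {1..n}"
      using as by (cases as) (auto simp: n_algebra_def nu_def)
    then show ?thesis using Q nth_mem[of "j - 1" xs] by (auto simp: n_algebra_def)
  next
    case (E i)
    then show ?thesis using f by (auto simp: n_algebra_def nu_def)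
  qed
qed

lemma head_normal_form_exists_aux:
  assumes F: "\<And>as. as \<in> lists (E ` {1..n}) \<Longrightarrow> length as = k \<Longrightarrow> F as \<in> E ` {1..n}"
  shows "p \<in> lists (E ` {1..n}) \<Longrightarrow> length p + m = k \<Longrightarrow>
    \<exists>t. head_normal_form n t \<and> vars t \<subseteq> {..<k} \<and>
      (\<forall>as\<in>lists (E ` {1..n}). length as = m \<longrightarrow>
         term_function (n_algebra n) t (p @ as) = F (p @ as))"
proof (induction m arbitrary: p)
  case 0
  then obtain i where i: "i \<in> {1..n}" "F p = E i" using F[of p] by auto
  then show ?case
    by (intro exI[of _ "App (E i) []"])
      (auto simp: term_function_def n_algebra_def intro: head_normal_form.const)
next
  case (Suc m)
  have "\<forall>j\<in>{1..n}. \<exists>t. head_normal_form n t \<and> vars t \<subseteq> {..<k} \<and>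
      (\<forall>as\<in>lists (E ` {1..n}). length as = m \<longrightarrow>
         term_function (n_algebra n) t ((p @ [E j]) @ as) = F ((p @ [E j]) @ as))"
    using Suc.prems by (intro ballI Suc.IH) auto
  then obtain T where T: "\<And>j. j \<in> {1..n} \<Longrightarrow> head_normal_form n (T j) \<and> vars (T j) \<subseteq> {..<k} \<and>
      (\<forall>as\<in>lists (E ` {1..n}). length as = m \<longrightarrow>
         term_function (n_algebra n) (T j) ((p @ [E j]) @ as) = F ((p @ [E j]) @ as))"
    by metis
  define t where "t = App Q (Var (length p) # map T [1..<Suc n])"
  have "head_normal_form n t"
    unfolding t_def using T by (intro head_normal_form.q) auto
  moreover have "vars t \<subseteq> {..<k}"
    using T Suc.prems(2) unfolding t_def by fastforce
  moreover have "term_function (n_algebra n) t (p @ as) = F (p @ as)"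
    if as: "as \<in> lists (E ` {1..n})" "length as = Suc m" for as
  proof -
    obtain j bs where j: "as = E j # bs" "j \<in> {1..n}" "bs \<in> lists (E ` {1..n})" "length bs = m"
      using as by (cases as) auto
    then have "map T [1..<Suc n] ! (j - 1) = T j"
      by (subst nth_map) (auto simp del: upt_Suc)
    then have "term_function (n_algebra n) t (p @ as) = term_function (n_algebra n) (T j) (p @ as)"
      using j unfolding t_def term_function_def
      by (auto simp: n_algebra_def simp del: upt_Suc)
    also have "\<dots> = F (p @ as)" using T[OF j(2)] j by auto
    finally show ?thesis .
  qed
  ultimately show ?case by blast
qed

text \<open>Head normal forms as required by \<open>hnf_choice\<close> always exist.\<close>

lemma hnf_choice_exists:
  assumes A: "algebra_of_type \<tau> A" and bij: "bij_betw \<iota> (carrier A) (carrier (n_algebra n))"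
  shows "\<exists>c. hnf_choice n \<tau> A \<iota> c"
proof -
  have im: "\<iota> ` carrier A = E ` {1..n}" and inj: "inj_on \<iota> (carrier A)"
    using bij by (auto simp: bij_betw_def n_algebra_def)
  define \<kappa> where "\<kappa> = inv_into (carrier A) \<iota>"
  have \<kappa>: "\<kappa> b \<in> carrier A" if "b \<in> E ` {1..n}" for b
    using that im unfolding \<kappa>_def by (metis inv_into_into)
  have "\<exists>t. head_normal_form n t \<and> vars t \<subseteq> {..<arity \<tau> f} \<and>
        (\<forall>as\<in>lists (carrier A). length as = arity \<tau> f \<longrightarrow>
           term_function (n_algebra n) t (map \<iota> as) = \<iota> (interp A f as))"
    if f: "f \<in> ops \<tau>" for f
  proof -
    define F where "F bs = \<iota> (interp A f (map \<kappa> bs))" for bs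
    have "F bs \<in> E ` {1..n}" if "bs \<in> lists (E ` {1..n})" "length bs = arity \<tau> f" for bs
    proof -
      have "map \<kappa> bs \<in> lists (carrier A)" using that \<kappa> by (auto simp: in_lists_conv_set)
      then have "interp A f (map \<kappa> bs) \<in> carrier A"
        using A f that(2) unfolding algebra_of_type_def by auto
      then show ?thesis using im unfolding F_def by blast
    qed
    from head_normal_form_exists_aux[of n "arity \<tau> f" F "[]" "arity \<tau> f", OF this]
    obtain t where t: "head_normal_form n t" "vars t \<subseteq> {..<arity \<tau> f}"
      "\<And>bs. bs \<in> lists (E ` {1..n}) \<Longrightarrow> length bs = arity \<tau> f \<Longrightarrow>
         term_function (n_algebra n) t bs = F bs"
      by auto
    have "term_function (n_algebra n) t (map \<iota> as) = \<iota> (interp A f as)"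
      if "as \<in> lists (carrier A)" "length as = arity \<tau> f" for as
    proof -
      have "map \<iota> as \<in> lists (E ` {1..n})" using that im by (auto simp: in_lists_conv_set)
      moreover have "map \<kappa> (map \<iota> as) = as"
        using that inj by (auto simp: \<kappa>_def in_lists_conv_set intro!: map_idI)
      ultimately show ?thesis using t(3)[of "map \<iota> as"] that(2) by (simp add: F_def)
    qed
    with t show ?thesis by blast
  qed
  then show ?thesis unfolding hnf_choice_def by metis
qed

end

theory Submission
  imports Defs
begin

text \<open>Homomorphisms out of the formula algebra are exactly evaluations under assignments.
  Along the bijection \<open>\<iota>\<close>, assignments into \<open>A\<close> correspond to assignments into
  \<open>\<^bold>n\<close>, and the value of \<open>\<phi>\<^sup>*\<close> is the \<open>\<iota>\<close>-image of the value of
  \<open>\<phi>\<close>; since \<open>\<iota>\<close> sends \<open>t\<close> to \<open>E n\<close>, \<open>\<phi>\<close> takes the designated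
  value under \<open>v\<close> iff \<open>\<phi>\<^sup>*\<close> does under \<open>\<iota> \<circ> v\<close>.\<close>

lemma eval_in_carrier:
  assumes "algebra_of_type \<sigma> B" and "range v \<subseteq> carrier B" and "\<phi> \<in> formulas \<sigma>"
  shows "eval B v \<phi> \<in> carrier B"
  using assms(3)
proof induction
  case (Var x)
  then show ?case using assms(2) by auto
next
  case (App f ts)
  then have "map (eval B v) ts \<in> lists (carrier B)" by (auto simp: in_lists_conv_set)
  then show ?case using App assms(1) by (auto simp: algebra_of_type_def)
qed

lemma homomorphism_eval:
  assumes "algebra_of_type \<sigma> B" and "range v \<subseteq> carrier B"
  shows "homomorphism \<sigma> (formula_algebra \<sigma>) B (eval B v)"
  using eval_in_carrier[OF assms] by (auto simp: homomorphism_def formula_algebra_def)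

text \<open>Variables generate the formula algebra, so their images determine \<open>h\<close>
  there. Outside \<open>formulas \<sigma>\<close> the total function \<open>h\<close> is arbitrary,
  so agreement is claimed for formulas only.\<close>

lemma homomorphism_eq_eval:
  assumes "homomorphism \<sigma> (formula_algebra \<sigma>) B h" and "\<phi> \<in> formulas \<sigma>"
  shows "h \<phi> = eval B (\<lambda>x. h (Var x)) \<phi>"
  using assms(2)
proof induction
  case (Var x)
  then show ?case by simp
next
  case (App f ts)
  then have "ts \<in> lists (formulas \<sigma>)" by (auto simp: in_lists_conv_set)
  then have "h (App f ts) = interp B f (map h ts)"
    using App assms(1) by (auto simp: homomorphism_def formula_algebra_def)
  also have "map h ts = map (eval B (\<lambda>x. h (Var x))) ts" using App by auto
  finally show ?case by simp
qed

text \<open>Trades homomorphisms for assignments: those into \<open>A\<close> and into the algebra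
  on \<open>E 1, ..., E n\<close> can be compared along \<open>\<iota>\<close>, whereas
  homomorphisms out of formula algebras of different types cannot be compared directly.\<close>

lemma consequence_iff_eval:
  assumes B: "algebra_of_type \<sigma> B" and fm: "\<Gamma> \<union> {\<phi>} \<subseteq> formulas \<sigma>"
  shows "consequence \<sigma> B d \<Gamma> \<phi> \<longleftrightarrow>
    (\<forall>v. range v \<subseteq> carrier B \<longrightarrow> (\<forall>\<psi>\<in>\<Gamma>. eval B v \<psi> = d) \<longrightarrow> eval B v \<phi> = d)"
    (is "?L \<longleftrightarrow> ?R")
proof
  assume ?L
  then show ?R using homomorphism_eval[OF B] unfolding consequence_def by blast
next
  assume R: ?R
  show ?L
    unfolding consequence_def
  proof (intro allI impI)
    fix h
    assume h: "homomorphism \<sigma> (formula_algebra \<sigma>) B h" and d: "\<forall>\<psi>\<in>\<Gamma>. h \<psi> = d"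
    have "range (\<lambda>x. h (Var x)) \<subseteq> carrier B"
      using h by (auto simp: homomorphism_def formula_algebra_def intro: formulas.Var)
    moreover have "\<forall>\<psi>\<in>\<Gamma>. eval B (\<lambda>x. h (Var x)) \<psi> = d"
      using d fm homomorphism_eq_eval[OF h] by (metis UnI1 subsetD)
    ultimately show "h \<phi> = d" using R fm homomorphism_eq_eval[OF h] by auto
  qed
qed

lemma eval_subst: "eval B v (subst s u) = eval B (\<lambda>x. eval B v (s x)) u"
  by (induction u) (auto simp: comp_def cong: map_cong)

text \<open>Serves assignments read off from lists: \<open>!\<close> is unspecified past the end of
  a list, so two of them may be comparable only on the variables that occur.\<close>

lemma eval_cong_vars: "(\<And>x. x \<in> vars u \<Longrightarrow> v x = w x) \<Longrightarrow> eval B v u = eval B w u"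
proof (induction u)
  case (App f us)
  then have "map (eval B v) us = map (eval B w) us" by fastforce
  then show ?case by (metis eval.simps(2))
qed simp

lemma head_normal_form_in_formulas: "head_normal_form n u \<Longrightarrow> u \<in> formulas (nu n)"
  by (induction rule: head_normal_form.induct) (auto simp: nu_def intro!: formulas.intros)

text \<open>Restricting the condition to occurring variables suits \<open>translate\<close>, whose
  substitution by \<open>!\<close> need not yield formulas at indices past the end of the argument
  list.\<close>

lemma subst_in_formulas:
  "u \<in> formulas \<sigma> \<Longrightarrow> (\<And>x. x \<in> vars u \<Longrightarrow> s x \<in> formulas \<sigma>) \<Longrightarrow> subst s u \<in> formulas \<sigma>"
proof (induction rule: formulas.induct)
  case (App f ts)
  then have "\<forall>t\<in>set ts. subst s t \<in> formulas \<sigma>" by fastforce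
  then show ?case using App by (auto intro!: formulas.App)
qed simp

lemma translate_in_formulas:
  assumes "hnf_choice n \<tau> A \<iota> c" and "\<phi> \<in> formulas \<tau>"
  shows "translate c \<phi> \<in> formulas (nu n)"
  using assms(2)
proof induction
  case (Var x)
  then show ?case by (simp add: formulas.Var)
next
  case (App f ts)
  then have hnf: "head_normal_form n (c f)" and vars: "vars (c f) \<subseteq> {..<length ts}"
    using assms(1) by (auto simp: hnf_choice_def)
  have "map (translate c) ts ! x \<in> formulas (nu n)" if "x \<in> vars (c f)" for x
    using that vars App by (auto simp: subset_iff)
  then show ?case
    using subst_in_formulas[OF head_normal_form_in_formulas[OF hnf]] by simp
qed

text \<open>In the inductive step, substitution followed by evaluation is the term function of
  \<open>c f\<close> at the values of the translated arguments. By induction these are the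
  \<open>\<iota>\<close>-images of the original values, and \<open>hnf_choice\<close> says that
  \<open>c f\<close> simulates \<open>f\<close> on such images.\<close>

lemma eval_translate:
  assumes A: "algebra_of_type \<tau> A" and c: "hnf_choice n \<tau> A \<iota> c"
    and v: "range v \<subseteq> carrier A" and "\<phi> \<in> formulas \<tau>"
  shows "eval (n_algebra n) (\<iota> \<circ> v) (translate c \<phi>) = \<iota> (eval A v \<phi>)"
  using assms(4)
proof induction
  case (Var x)
  then show ?case by simp
next
  case (App f ts)
  let ?as = "map (eval A v) ts"
  have as: "?as \<in> lists (carrier A)"
    using App eval_in_carrier[OF A v] by (auto simp: in_lists_conv_set)
  have vars: "vars (c f) \<subseteq> {..<length ts}"
    using App c by (auto simp: hnf_choice_def)
  have "eval (n_algebra n) (\<iota> \<circ> v) (translate c (App f ts)) =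
      term_function (n_algebra n) (c f) (map \<iota> ?as)"
    unfolding translate.simps eval_subst term_function_def
    \<comment> \<open>Both assignments index lists of length \<open>length ts\<close>;
      \<open>vars\<close> keeps the variables of \<open>c f\<close> below that bound.\<close>
    using vars App.IH by (intro eval_cong_vars) (auto simp: subset_iff comp_def)
  also have "\<dots> = \<iota> (interp A f ?as)"
    using c as App.hyps unfolding hnf_choice_def by (metis length_map)
  finally show ?case by (simp add: comp_def)
qed

theorem theorem7p5:
  fixes n :: nat
    and \<tau> :: "'f signature"
    and A :: "('f, 'a) algebra"
    and t :: 'a
    and \<iota> :: "'a \<Rightarrow> nu_sym"
    and c :: "'f \<Rightarrow> nu_sym trm"
    and \<Gamma> :: "'f trm set"
    and \<phi> :: "'f trm"
  assumes "n \<ge> 2"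
    and "algebra_of_type \<tau> A"
    and "card (carrier A) = n"
    and "t \<in> carrier A"
    and "bij_betw \<iota> (carrier A) (carrier (n_algebra n))"
    and "\<iota> t = E n"
    and "hnf_choice n \<tau> A \<iota> c"
    and "\<Gamma> \<union> {\<phi>} \<subseteq> formulas \<tau>"
  shows "consequence \<tau> A t \<Gamma> \<phi> \<longleftrightarrow> nCL n (translate c ` \<Gamma>) (translate c \<phi>)"
proof -
  let ?N = "n_algebra n"
  have N: "algebra_of_type (nu n) ?N" using assms(1) by (intro algebra_of_type_n_algebra) simp
  have fm: "translate c ` \<Gamma> \<union> {translate c \<phi>} \<subseteq> formulas (nu n)"
    using assms(8) translate_in_formulas[OF assms(7)] by auto
  have im: "\<iota> ` carrier A = carrier ?N" and inj: "inj_on \<iota> (carrier A)"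
    using assms(5) by (auto simp: bij_betw_def)
  \<comment> \<open>From left to right: \<open>eval A v \<psi>\<close> and \<open>t\<close> lie in
    the carrier and share the image \<open>E n\<close>, so injectivity of \<open>\<iota>\<close>
    identifies them.\<close>
  have designated: "eval ?N (\<iota> \<circ> v) (translate c \<psi>) = E n \<longleftrightarrow> eval A v \<psi> = t"
    if "range v \<subseteq> carrier A" and "\<psi> \<in> formulas \<tau>" for v \<psi>
    using eval_translate[OF assms(2,7) that] eval_in_carrier[OF assms(2) that] inj assms(4,6)
    by (metis inj_onD)
  \<comment> \<open>Surjectivity of \<open>\<iota>\<close> enters here: \<open>w\<close> is pulled
    back pointwise by \<open>inv_into\<close>, so a quantifier over \<open>w\<close> becomes one
    over \<open>\<iota> \<circ> v\<close>.\<close>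
  have assignments: "{w. range w \<subseteq> carrier ?N} = (\<lambda>v. \<iota> \<circ> v) ` {v. range v \<subseteq> carrier A}"
  proof (intro equalityI subsetI)
    fix w assume "w \<in> {w. range w \<subseteq> carrier ?N}"
    then have w: "w x \<in> \<iota> ` carrier A" for x using im by auto
    have "w = \<iota> \<circ> (inv_into (carrier A) \<iota> \<circ> w)"
      using w by (auto simp: f_inv_into_f)
    moreover have "range (inv_into (carrier A) \<iota> \<circ> w) \<subseteq> carrier A"
      using w by (auto intro: inv_into_into)
    ultimately show "w \<in> (\<lambda>v. \<iota> \<circ> v) ` {v. range v \<subseteq> carrier A}" by blast
  qed (use im in \<open>auto simp: subset_iff\<close>)
  have "nCL n (translate c ` \<Gamma>) (translate c \<phi>) \<longleftrightarrow>
      (\<forall>w\<in>{w. range w \<subseteq> carrier ?N}.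
        (\<forall>\<psi>\<in>\<Gamma>. eval ?N w (translate c \<psi>) = E n) \<longrightarrow> eval ?N w (translate c \<phi>) = E n)"
    unfolding nCL_def consequence_iff_eval[OF N fm] by simp
  also have "\<dots> \<longleftrightarrow> (\<forall>v. range v \<subseteq> carrier A \<longrightarrow>
        (\<forall>\<psi>\<in>\<Gamma>. eval ?N (\<iota> \<circ> v) (translate c \<psi>) = E n) \<longrightarrow>
        eval ?N (\<iota> \<circ> v) (translate c \<phi>) = E n)"
    unfolding assignments by simp
  also have "\<dots> \<longleftrightarrow> (\<forall>v. range v \<subseteq> carrier A \<longrightarrow>
        (\<forall>\<psi>\<in>\<Gamma>. eval A v \<psi> = t) \<longrightarrow> eval A v \<phi> = t)"
    using designated assms(8) by (simp add: subset_iff)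
  also have "\<dots> \<longleftrightarrow> consequence \<tau> A t \<Gamma> \<phi>"
    unfolding consequence_iff_eval[OF assms(2,8)] ..
  finally show ?thesis by simp
qed

end
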